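(* Let $G$ be an abelian group, let $\Gamma,\Theta:\mathbb{Z}_2\to \mathrm{Aut}(G)$ be group homomorphisms, and let $G\rtimes_\Gamma\mathbb{Z}_2$ and $G\rtimes_\Theta\mathbb{Z}_2$ be the corresponding semidirect products. Let $X,Y$ be subsets of the Cartesian product $G\times\mathbb{Z}_2$. Suppose that $\mathrm{Inv}(Y;G\rtimes_\Gamma\mathbb{Z}_2)=\mathrm{Inv}(Y;G\rtimes_\Theta\mathbb{Z}_2)$ (denote this set by $Z$) and that $\Gamma_1(Z)=\Theta_1(Z)$. Let $\lambda$ be a positive integer. Then: (i) $D(X,Y;G\rtimes_\Gamma\mathbb{Z}_2)=D(X,Y;G\rtimes_\Theta\mathbb{Z}_2)$ (as multisets); (ii) $\{X,Y\}$ is a $(2|G|,2;|X|,|Y|;\lambda,\lambda)$-GSEDF in $G\rtimes_\Gamma\mathbb{Z}_2$ if and only if $\{X,Y\}$ is a $(2|G|,2;|X|,|Y|;\lambda,\lambda)$-GSEDF in $G\rtimes_\Theta\mathbb{Z}_2$. Moreover, if $X=Y$, then: (iii) $D(X;G\rtimes_\Gamma\mathbb{Z}_2)=D(X;G\rtimes_\Theta\mathbb{Z}_2)$ (as multisets); (iv) $X$ is a $(2|G|,|X|,\lambda)$-DS in $G\rtimes_\Gamma\mathbb{Z}_2$ if and only if $X$ is a $(2|G|,|X|,\lambda)$-DS in $G\rtimes_\Theta\mathbb{Z}_2$.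
   Context: For a homomorphism $\Gamma:\mathbb{Z}_2\to\mathrm{Aut}(G)$, write $\Gamma_h$ for the automorphism associated to $h\in\mathbb{Z}_2=\{0,1\}$. The semidirect product $G\rtimes_\Gamma\mathbb{Z}_2$ has underlying set the Cartesian product $G\times\mathbb{Z}_2$ and multiplication $(g_1,h_1)*_\Gamma(g_2,h_2)=(g_1\Gamma_{h_1}(g_2),h_1+h_2)$. All semidirect products of $G$ and $\mathbb{Z}_2$ thus share the same underlying set. An automorphism $f$ of $G$ is extended to the set $G\times\mathbb{Z}_2$ by $f(x,y)=(f(x),y)$; so $\Gamma_1(Z)=\{(\Gamma_1(g),h):(g,h)\in Z\}$. For a group $K$ with multiplication $*$, identity $e$, and subsets $X,Y\subseteq K$: $\mathrm{Inv}(X;K)$ is the set of inverses in $K$ of the elements of $X$; $S(X,Y;K)$ is the multiset $\{x*y:x\in X,\,y\in Y\}$; $D(X,Y;K)$ is the multiset $S(X,\mathrm{Inv}(Y;K);K)$; and $D(X;K)$ is the multiset $D(X,X;K)$ with $|X|$ copies of $e$ removed. For a multiset $D$, $\lambda D$ denotes the multiset consisting of $\lambda$ copies of $D$. For a group $K$ of order $v$ with identity $e$: a subset $A\subseteq K$ of size $k$ is a $(v,k,\lambda)$-difference set (DS) if $D(A;K)=\lambda(K\setminus\{e\})$. A family $\{A_0,A_1\}$ of two disjoint subsets of $K$ with $|A_0|=l_0$, $|A_1|=l_1$ is a $(v,2;l_0,l_1;\lambda_0,\lambda_1)$-GSEDF (generalized strong external difference family) if $D(A_0,A_1;K)=\lambda_0(K\setminus\{e\})$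 and $D(A_1,A_0;K)=\lambda_1(K\setminus\{e\})$ as multisets. *)

theory Defs
  imports "HOL-Algebra.Bij" "HOL-Algebra.Elementary_Groups" "HOL-Library.Multiset"
begin

definition semidirect ::
  "('a, 'm) monoid_scheme \<Rightarrow> ('b, 'n) monoid_scheme \<Rightarrow> ('b \<Rightarrow> 'a \<Rightarrow> 'a) \<Rightarrow> ('a \<times> 'b) monoid"
  where
  "semidirect G H \<Gamma> =
     \<lparr>carrier = carrier G \<times> carrier H,
      monoid.mult = (\<lambda>(g\<^sub>1, h\<^sub>1) (g\<^sub>2, h\<^sub>2). (g\<^sub>1 \<otimes>\<^bsub>G\<^esub> \<Gamma> h\<^sub>1 g\<^sub>2, h\<^sub>1 \<otimes>\<^bsub>H\<^esub> h\<^sub>2)),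
      one = (\<one>\<^bsub>G\<^esub>, \<one>\<^bsub>H\<^esub>)\<rparr>"

abbreviation Z2 :: "int monoid"
  where "Z2 \<equiv> integer_mod_group 2"

definition extend_fst :: "('a \<Rightarrow> 'a) \<Rightarrow> 'a \<times> 'b \<Rightarrow> 'a \<times> 'b"
  where "extend_fst f = (\<lambda>(x, y). (f x, y))"

text \<open>
  The multisets below are finite multisets of the library, and \<open>mset_set\<close> of an infinite set is
  empty. Hence \<open>S_mset\<close>, \<open>D_mset\<close> and \<open>D_self\<close> have their intended meaning for finite sets only.
  The set \<open>Inv(Y; K)\<close> is the library's \<open>set_inv\<^bsub>K\<^esub> Y\<close>.
\<close>

definition S_mset :: "('a, 'm) monoid_scheme \<Rightarrow> 'a set \<Rightarrow> 'a set \<Rightarrow> 'a multiset"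
  where "S_mset K X Y = image_mset (\<lambda>(x, y). x \<otimes>\<^bsub>K\<^esub> y) (mset_set (X \<times> Y))"

definition D_mset :: "('a, 'm) monoid_scheme \<Rightarrow> 'a set \<Rightarrow> 'a set \<Rightarrow> 'a multiset"
  where "D_mset K X Y = S_mset K X (set_inv\<^bsub>K\<^esub> Y)"

definition D_self :: "('a, 'm) monoid_scheme \<Rightarrow> 'a set \<Rightarrow> 'a multiset"
  where "D_self K X = D_mset K X X - replicate_mset (card X) \<one>\<^bsub>K\<^esub>"

text \<open>
  In the next two definitions finiteness of \<open>K\<close> is stated explicitly because \<open>order K\<close> is \<open>0\<close> for
  infinite \<open>K\<close>.
\<close>

definition is_DS :: "('a, 'm) monoid_scheme \<Rightarrow> nat \<Rightarrow> nat \<Rightarrow> nat \<Rightarrow> 'a set \<Rightarrow> bool"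
  where
  "is_DS K v k l A \<longleftrightarrow>
     group K \<and> finite (carrier K) \<and> order K = v \<and>
     A \<subseteq> carrier K \<and> card A = k \<and>
     D_self K A = repeat_mset l (mset_set (carrier K - {\<one>\<^bsub>K\<^esub>}))"

text \<open>
  \<open>is_GSEDF2 K v l\<^sub>0 l\<^sub>1 m\<^sub>0 m\<^sub>1 A\<^sub>0 A\<^sub>1\<close>: the family \<open>{A\<^sub>0, A\<^sub>1}\<close> is a
  \<open>(v, 2; l\<^sub>0, l\<^sub>1; m\<^sub>0, m\<^sub>1)\<close>-GSEDF in \<open>K\<close>.
\<close>

definition is_GSEDF2 ::
  "('a, 'm) monoid_scheme \<Rightarrow> nat \<Rightarrow> nat \<Rightarrow> nat \<Rightarrow> nat \<Rightarrow> nat \<Rightarrow> 'a set \<Rightarrow> 'a set \<Rightarrow> bool"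
  where
  "is_GSEDF2 K v l\<^sub>0 l\<^sub>1 m\<^sub>0 m\<^sub>1 A\<^sub>0 A\<^sub>1 \<longleftrightarrow>
     group K \<and> finite (carrier K) \<and> order K = v \<and>
     A\<^sub>0 \<subseteq> carrier K \<and> A\<^sub>1 \<subseteq> carrier K \<and> A\<^sub>0 \<inter> A\<^sub>1 = {} \<and>
     card A\<^sub>0 = l\<^sub>0 \<and> card A\<^sub>1 = l\<^sub>1 \<and>
     D_mset K A\<^sub>0 A\<^sub>1 = repeat_mset m\<^sub>0 (mset_set (carrier K - {\<one>\<^bsub>K\<^esub>})) \<and>
     D_mset K A\<^sub>1 A\<^sub>0 = repeat_mset m\<^sub>1 (mset_set (carrier K - {\<one>\<^bsub>K\<^esub>}))"

end

theory Submission
  imports Defs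
begin

text \<open>
  A multiset of products \<open>x * z\<close> with \<open>x \<in> X\<close>, \<open>z \<in> Z\<close> in a group is the sum of the left translates
  \<open>x * Z\<close>, each of them a set because left translation is injective. In a semidirect product the
  translate of \<open>Z\<close> by \<open>(g, h)\<close> is obtained by first applying \<open>\<Gamma>\<^sub>h\<close> to the first coordinates of \<open>Z\<close>
  and then a map that involves only \<open>g\<close>, \<open>h\<close> and the two factors. So the multiset depends on the
  action \<open>\<Gamma>\<close> only through the sets \<open>\<Gamma>\<^sub>h(Z)\<close>. For \<open>\<int>\<^sub>2\<close> the set for \<open>h = 0\<close> is \<open>Z\<close> itself, and the sets for
  \<open>h = 1\<close> agree by hypothesis; applied to \<open>Z = Inv(Y)\<close> this is the equality of the multisets of
  differences \<open>D(X, Y)\<close> (lemmas \<open>S_mset_eq_sum_l_cosets\<close>, \<open>l_coset_semidirect\<close> and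
  \<open>S_mset_semidirect_cong\<close>).

  The definition of a GSEDF also speaks of \<open>D(Y, X)\<close>, for which the hypotheses, asymmetric in \<open>X\<close>
  and \<open>Y\<close>, give no direct comparison. But \<open>D(Y, X)\<close> consists of the inverses of the elements of
  \<open>D(X, Y)\<close>, and inversion permutes the non-identity elements; hence the condition on \<open>D(Y, X)\<close>
  follows from the one on \<open>D(X, Y)\<close> whenever both have the same \<open>\<lambda>\<close>
  (lemmas \<open>D_mset_swap\<close> and \<open>D_mset_swap_uniform\<close>).
\<close>

section \<open>Multisets of products and of differences in a group\<close>

lemma image_mset_repeat_mset:
  "image_mset f (repeat_mset n M) = repeat_mset n (image_mset f M)"
  by (induction n) simp_all

lemma mset_set_insert_Times:
  assumes "finite X" "finite Z" "x \<notin> X"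
  shows "mset_set (insert x X \<times> Z) = image_mset (Pair x) (mset_set Z) + mset_set (X \<times> Z)"
proof -
  have "insert x X \<times> Z = Pair x ` Z \<union> X \<times> Z"
    by auto
  moreover have "Pair x ` Z \<inter> X \<times> Z = {}"
    using assms(3) by auto
  ultimately show ?thesis
    using assms by (simp add: mset_set_Union image_mset_mset_set inj_on_def)
qed

context group
begin

text \<open>
  Repetitions in a multiset of products come only from different translates, since \<open>x <# Z\<close> has one
  element for each element of \<open>Z\<close>.
\<close>

lemma S_mset_eq_sum_l_cosets:
  assumes "finite X" "finite Z" "X \<subseteq> carrier G" "Z \<subseteq> carrier G"
  shows "S_mset G X Z = (\<Sum>x\<in>X. mset_set (x <# Z))"
  using assms(1,3)
proof (induction X rule: finite_induct)
  case empty
  then show ?case by (simp add: S_mset_def)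
next
  case (insert x X)
  have "inj_on ((\<otimes>) x) Z"
    using insert.prems assms(4) by (intro inj_on_subset[OF inj_on_cmult]) auto
  then have "image_mset ((\<otimes>) x) (mset_set Z) = mset_set (x <# Z)"
    by (simp add: image_mset_mset_set l_coset_def UNION_singleton_eq_range)
  then show ?case
    using insert assms(2)
    by (simp add: S_mset_def mset_set_insert_Times multiset.map_comp comp_def)
qed

lemma set_inv_subset_carrier: "Y \<subseteq> carrier G \<Longrightarrow> set_inv Y \<subseteq> carrier G"
  by (auto simp: SET_INV_def)

lemma D_mset_eq_image:
  assumes "Y \<subseteq> carrier G"
  shows "D_mset G X Y = image_mset (\<lambda>(x, y). x \<otimes> inv y) (mset_set (X \<times> Y))"
proof -
  have inj: "inj_on (map_prod id (m_inv G)) (X \<times> Y)"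
    using assms by (intro map_prod_inj_on) (auto intro: inj_on_subset[OF inv_inj])
  have "X \<times> set_inv Y = map_prod id (m_inv G) ` (X \<times> Y)"
    by (force simp: SET_INV_def)
  then have "mset_set (X \<times> set_inv Y) = image_mset (map_prod id (m_inv G)) (mset_set (X \<times> Y))"
    using image_mset_mset_set[OF inj] by simp
  then show ?thesis
    by (simp add: D_mset_def S_mset_def multiset.map_comp comp_def case_prod_unfold)
qed

text \<open>This is the identity \<open>y * x\<^sup>-\<^sup>1 = (x * y\<^sup>-\<^sup>1)\<^sup>-\<^sup>1\<close>, read for all pairs at once.\<close>

lemma D_mset_swap:
  assumes "X \<subseteq> carrier G" "Y \<subseteq> carrier G"
  shows "D_mset G Y X = image_mset (m_inv G) (D_mset G X Y)"
proof -
  have "mset_set (Y \<times> X) = image_mset prod.swap (mset_set (X \<times> Y))"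
    by (simp add: image_mset_mset_set product_swap)
  moreover have "prod.swap p \<in> Y \<times> X" "p \<in> carrier G \<times> carrier G"
    if "p \<in># mset_set (X \<times> Y)" for p
    using that assms by (cases "finite (X \<times> Y)"; force)+
  ultimately show ?thesis
    using assms
    by (auto simp: D_mset_eq_image multiset.map_comp inv_mult_group intro!: image_mset_cong)
qed

lemma D_mset_swap_uniform:
  assumes "X \<subseteq> carrier G" "Y \<subseteq> carrier G"
    and "D_mset G X Y = repeat_mset l (mset_set (carrier G - {\<one>}))"
  shows "D_mset G Y X = repeat_mset l (mset_set (carrier G - {\<one>}))"
proof -
  have inj: "inj_on (m_inv G) (carrier G - {\<one>})"
    by (rule inj_on_subset[OF inv_inj]) auto
  have "m_inv G ` (carrier G - {\<one>}) = carrier G - {\<one>}"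
  proof
    show "m_inv G ` (carrier G - {\<one>}) \<subseteq> carrier G - {\<one>}"
      by (auto simp: inv_eq_1_iff)
    show "carrier G - {\<one>} \<subseteq> m_inv G ` (carrier G - {\<one>})"
      by (rule subsetI, rule_tac x = "inv x" in image_eqI) (auto simp: inv_eq_1_iff)
  qed
  then show ?thesis
    using assms(3) by (simp add: D_mset_swap[OF assms(1,2)] image_mset_repeat_mset image_mset_mset_set[OF inj])
qed

end

section \<open>Semidirect products\<close>

lemma semidirect_simps [simp]:
  "carrier (semidirect G H \<Gamma>) = carrier G \<times> carrier H"
  "monoid.mult (semidirect G H \<Gamma>) (a, h) (b, k) = (a \<otimes>\<^bsub>G\<^esub> \<Gamma> h b, h \<otimes>\<^bsub>H\<^esub> k)"
  "one (semidirect G H \<Gamma>) = (\<one>\<^bsub>G\<^esub>, \<one>\<^bsub>H\<^esub>)"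
  by (simp_all add: semidirect_def)

lemma hom_AutoGroup_hom:
  assumes "\<Gamma> \<in> hom H (AutoGroup G)" "h \<in> carrier H"
  shows "\<Gamma> h \<in> hom G G"
  using hom_in_carrier[OF assms] by (simp add: AutoGroup_def auto_def)

lemma hom_AutoGroup_mult:
  assumes "\<Gamma> \<in> hom H (AutoGroup G)" "h \<in> carrier H" "k \<in> carrier H" "x \<in> carrier G"
  shows "\<Gamma> (h \<otimes>\<^bsub>H\<^esub> k) x = \<Gamma> h (\<Gamma> k x)"
proof -
  have "\<Gamma> h \<in> Bij (carrier G)" "\<Gamma> k \<in> Bij (carrier G)"
    using hom_in_carrier[OF assms(1)] assms(2,3) by (auto simp: AutoGroup_def auto_def)
  then show ?thesis
    using hom_mult[OF assms(1-3)] assms(4)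
    by (simp add: AutoGroup_def BijGroup_def compose_def)
qed

lemma hom_AutoGroup_one:
  assumes "group G" "group H" "\<Gamma> \<in> hom H (AutoGroup G)" "x \<in> carrier G"
  shows "\<Gamma> \<one>\<^bsub>H\<^esub> x = x"
proof -
  have "\<Gamma> \<one>\<^bsub>H\<^esub> = \<one>\<^bsub>AutoGroup G\<^esub>"
    using hom_one[OF assms(3,2) group.AutoGroup[OF assms(1)]] .
  then show ?thesis
    using assms(4) by (simp add: AutoGroup_def BijGroup_def)
qed

lemma group_semidirect:
  assumes "group G" "group H" and \<Gamma>: "\<Gamma> \<in> hom H (AutoGroup G)"
  shows "group (semidirect G H \<Gamma>)"
proof -
  interpret G: group G by fact
  interpret H: group H by fact
  have cl: "\<Gamma> h x \<in> carrier G" if "h \<in> carrier H" "x \<in> carrier G" for h x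
    using hom_in_carrier[OF hom_AutoGroup_hom[OF \<Gamma> that(1)] that(2)] .
  have ml: "\<Gamma> h (x \<otimes>\<^bsub>G\<^esub> y) = \<Gamma> h x \<otimes>\<^bsub>G\<^esub> \<Gamma> h y"
    if "h \<in> carrier H" "x \<in> carrier G" "y \<in> carrier G" for h x y
    using hom_mult[OF hom_AutoGroup_hom[OF \<Gamma> that(1)] that(2,3)] .
  have linv: "\<exists>q \<in> carrier G \<times> carrier H. q \<otimes>\<^bsub>semidirect G H \<Gamma>\<^esub> (a, h) = (\<one>\<^bsub>G\<^esub>, \<one>\<^bsub>H\<^esub>)"
    if "a \<in> carrier G" "h \<in> carrier H" for a h
  proof
    show "(\<Gamma> (inv\<^bsub>H\<^esub> h) (inv\<^bsub>G\<^esub> a), inv\<^bsub>H\<^esub> h) \<in> carrier G \<times> carrier H"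
      using that cl by simp
    have "\<Gamma> (inv\<^bsub>H\<^esub> h) (inv\<^bsub>G\<^esub> a) \<otimes>\<^bsub>G\<^esub> \<Gamma> (inv\<^bsub>H\<^esub> h) a = \<Gamma> (inv\<^bsub>H\<^esub> h) \<one>\<^bsub>G\<^esub>"
      using that by (simp flip: ml)
    also have "\<dots> = \<one>\<^bsub>G\<^esub>"
      using that by (simp add: hom_one[OF hom_AutoGroup_hom[OF \<Gamma>]] assms(1))
    finally show "(\<Gamma> (inv\<^bsub>H\<^esub> h) (inv\<^bsub>G\<^esub> a), inv\<^bsub>H\<^esub> h) \<otimes>\<^bsub>semidirect G H \<Gamma>\<^esub> (a, h) = (\<one>\<^bsub>G\<^esub>, \<one>\<^bsub>H\<^esub>)"
      using that by simp
  qed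
  show ?thesis
    by (rule groupI)
      (use linv in \<open>auto simp: cl ml hom_AutoGroup_mult[OF \<Gamma>] hom_AutoGroup_one[OF assms]
        G.m_assoc H.m_assoc\<close>)
qed

text \<open>
  The outer map is the translation by \<open>(g, h)\<close> in the direct product, so the action enters only
  through the set \<open>\<Gamma>\<^sub>h(Z)\<close>.
\<close>

lemma l_coset_semidirect:
  "(g, h) <#\<^bsub>semidirect G H \<Gamma>\<^esub> Z =
     (\<lambda>(a, b). (g \<otimes>\<^bsub>G\<^esub> a, h \<otimes>\<^bsub>H\<^esub> b)) ` extend_fst (\<Gamma> h) ` Z"
  by (force simp: l_coset_def extend_fst_def)

lemma S_mset_semidirect_cong:
  assumes "group (semidirect G H \<Gamma>)" "group (semidirect G H \<Theta>)"
    and "finite X" "finite Z" "X \<subseteq> carrier G \<times> carrier H" "Z \<subseteq> carrier G \<times> carrier H"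
    and eq: "\<And>h. h \<in> carrier H \<Longrightarrow> extend_fst (\<Gamma> h) ` Z = extend_fst (\<Theta> h) ` Z"
  shows "S_mset (semidirect G H \<Gamma>) X Z = S_mset (semidirect G H \<Theta>) X Z"
proof -
  have "x <#\<^bsub>semidirect G H \<Gamma>\<^esub> Z = x <#\<^bsub>semidirect G H \<Theta>\<^esub> Z" if "x \<in> X" for x
  proof (cases x)
    case (Pair g h)
    then have "h \<in> carrier H"
      using that assms(5) by auto
    then show ?thesis
      by (simp only: Pair l_coset_semidirect eq)
  qed
  then show ?thesis
    using assms(1-6) by (simp add: group.S_mset_eq_sum_l_cosets)
qed

lemma extend_fst_one_image:
  assumes "group G" "group H" "\<Gamma> \<in> hom H (AutoGroup G)" "Z \<subseteq> carrier G \<times> carrier H"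
  shows "extend_fst (\<Gamma> \<one>\<^bsub>H\<^esub>) ` Z = Z"
proof -
  have "extend_fst (\<Gamma> \<one>\<^bsub>H\<^esub>) z = z" if "z \<in> Z" for z
    using that assms(4) hom_AutoGroup_one[OF assms(1-3)] by (auto simp: extend_fst_def)
  then show ?thesis by simp
qed

section \<open>Difference sets and GSEDFs in two semidirect products\<close>

theorem theorem3p13:
  fixes G :: "('a, 'm) monoid_scheme"
    and \<Gamma> \<Theta> :: "int \<Rightarrow> 'a \<Rightarrow> 'a"
    and X Y Z :: "('a \<times> int) set"
    and l :: nat
  assumes "comm_group G"
    and "\<Gamma> \<in> hom Z2 (AutoGroup G)"
    and "\<Theta> \<in> hom Z2 (AutoGroup G)"
    and "X \<subseteq> carrier G \<times> carrier Z2" and "finite X"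
    and "Y \<subseteq> carrier G \<times> carrier Z2" and "finite Y"
    and "Z = set_inv\<^bsub>semidirect G Z2 \<Gamma>\<^esub> Y"
    and "Z = set_inv\<^bsub>semidirect G Z2 \<Theta>\<^esub> Y"
    and "extend_fst (\<Gamma> 1) ` Z = extend_fst (\<Theta> 1) ` Z"
    and "l > 0"
  shows "D_mset (semidirect G Z2 \<Gamma>) X Y = D_mset (semidirect G Z2 \<Theta>) X Y \<and>
    (is_GSEDF2 (semidirect G Z2 \<Gamma>) (2 * order G) (card X) (card Y) l l X Y \<longleftrightarrow>
     is_GSEDF2 (semidirect G Z2 \<Theta>) (2 * order G) (card X) (card Y) l l X Y) \<and>
    (X = Y \<longrightarrow>
     D_self (semidirect G Z2 \<Gamma>) X = D_self (semidirect G Z2 \<Theta>) X \<and>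
     (is_DS (semidirect G Z2 \<Gamma>) (2 * order G) (card X) l X \<longleftrightarrow>
      is_DS (semidirect G Z2 \<Theta>) (2 * order G) (card X) l X))"
proof -
  let ?K = "semidirect G Z2 \<Gamma>" and ?L = "semidirect G Z2 \<Theta>"
  have G: "group G"
    using assms(1) by (simp add: comm_group_def)
  have K: "group ?K" and L: "group ?L"
    using assms(2,3) by (auto intro: group_semidirect G)
  have Z: "Z \<subseteq> carrier G \<times> carrier Z2" "finite Z"
    using group.set_inv_subset_carrier[OF K, of Y] assms(6-8) by (auto simp: SET_INV_def)
  have "extend_fst (\<Gamma> h) ` Z = extend_fst (\<Theta> h) ` Z" if "h \<in> carrier Z2" for h
  proof (cases "h = 0")
    case True
    then show ?thesis
      using extend_fst_one_image[OF G group_integer_mod_group assms(2) Z(1)]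
        extend_fst_one_image[OF G group_integer_mod_group assms(3) Z(1)] by simp
  next
    case False
    then have "h = 1"
      using that by (auto simp: carrier_integer_mod_group)
    then show ?thesis
      using assms(10) by simp
  qed
  then have D: "D_mset ?K X Y = D_mset ?L X Y"
    using S_mset_semidirect_cong[OF K L assms(5) Z(2) assms(4) Z(1)] assms(8,9)
    by (simp add: D_mset_def)
  have "is_GSEDF2 ?K (2 * order G) (card X) (card Y) l l X Y \<longleftrightarrow>
      is_GSEDF2 ?L (2 * order G) (card X) (card Y) l l X Y"
    using D K L assms(4,6) group.D_mset_swap_uniform[OF K, of X Y l]
      group.D_mset_swap_uniform[OF L, of X Y l]
    by (auto simp: is_GSEDF2_def order_def)
  moreover have "D_self ?K X = D_self ?L X" if "X = Y"
    using that D by (simp add: D_self_def)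
  ultimately show ?thesis
    using D K L by (simp add: is_DS_def order_def)
qed

end
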